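(* Let $(X,d)$ be a metric space, let $D_n\subset X$ and $f_n:D_n\to D_{n+1}$ be maps for $n\ge 0$, and consider the non-autonomous system $x_{n+1}=f_n(x_n)$, $n\ge 0$. Let $V$ be an unbounded subset of $D_0$. If the system is topologically transitive in $V$ and $P(f_{0,\infty})\cap V$ is dense in $V$, then the system is sensitive in $V$, and the sensitivity constant can be taken to be an arbitrary positive number (i.e., every $\delta_0>0$ is a sensitivity constant of the system in $V$).
   Context: Notation: $f_0^0=\mathrm{id}$ and $f_0^n=f_{n-1}\circ\cdots\circ f_0$ on $D_0$ for $n\ge1$. No continuity of the $f_n$ is assumed. A point $p\in D_0$ is $k$-periodic ($k\ge 1$) if $f_0^{n+k}(p)=f_0^n(p)$ for all $n\ge 0$; $P(f_{0,\infty})$ is the set of all periodic points (i.e., $k$-periodic for some $k\geq 1$). The system is topologically transitive in a nonempty $V\subset D_0$ if for any two nonempty relatively open subsets $U_0,V_0$ of $V$ there is an integer $n\ge 1$ with $f_0^n(U_0)\cap V_0\ne\emptyset$. The system is sensitive in a nonempty $V\subset D_0$ if there is a constant $\delta_0>0$ (called a sensitivity constant of the system in $V$) such that for every $x_0\in V$ and every neighborhood $U$ of $x_0$ there exist $y_0\in V\cap U$ and a positive integer $n$ with $d(f_0^n(x_0),f_0^n(y_0))>\delta_0$. *)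

theory Defs
  imports "HOL-Analysis.Analysis"
begin

(* A non-autonomous system is a pair (D, f) with f n mapping D n into D (Suc n).
   Since HOL functions are total, f n also has values outside D n; these are never
   used, because all notions below only iterate from points of D 0. *)

definition nonautonomous_system ::
  "(nat \<Rightarrow> 'a::metric_space set) \<Rightarrow> (nat \<Rightarrow> 'a \<Rightarrow> 'a) \<Rightarrow> bool" where
  "nonautonomous_system D f \<longleftrightarrow> (\<forall>n. f n \<in> D n \<rightarrow> D (Suc n))"

primrec orbit_map :: "(nat \<Rightarrow> 'a \<Rightarrow> 'a) \<Rightarrow> nat \<Rightarrow> 'a \<Rightarrow> 'a" where
  "orbit_map f 0 = id"
| "orbit_map f (Suc n) = f n \<circ> orbit_map f n"

definition periodic_point ::
  "(nat \<Rightarrow> 'a set) \<Rightarrow> (nat \<Rightarrow> 'a \<Rightarrow> 'a) \<Rightarrow> nat \<Rightarrow> 'a \<Rightarrow> bool" where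
  "periodic_point D f k p \<longleftrightarrow>
     p \<in> D 0 \<and> k \<ge> 1 \<and> (\<forall>n. orbit_map f (n + k) p = orbit_map f n p)"

definition periodic_points :: "(nat \<Rightarrow> 'a set) \<Rightarrow> (nat \<Rightarrow> 'a \<Rightarrow> 'a) \<Rightarrow> 'a set" where
  "periodic_points D f = {p. \<exists>k\<ge>1. periodic_point D f k p}"

definition transitive_in ::
  "(nat \<Rightarrow> 'a::metric_space set) \<Rightarrow> (nat \<Rightarrow> 'a \<Rightarrow> 'a) \<Rightarrow> 'a set \<Rightarrow> bool" where
  "transitive_in D f V \<longleftrightarrow> V \<noteq> {} \<and> V \<subseteq> D 0 \<and>
     (\<forall>U\<^sub>0 V\<^sub>0. openin (top_of_set V) U\<^sub>0 \<and> U\<^sub>0 \<noteq> {} \<and> openin (top_of_set V) V\<^sub>0 \<and> V\<^sub>0 \<noteq> {} \<longrightarrow>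
        (\<exists>n\<ge>1. orbit_map f n ` U\<^sub>0 \<inter> V\<^sub>0 \<noteq> {}))"

(* A neighborhood of x is any set having x in its interior; it need not be open. *)

definition sensitivity_constant ::
  "(nat \<Rightarrow> 'a::metric_space set) \<Rightarrow> (nat \<Rightarrow> 'a \<Rightarrow> 'a) \<Rightarrow> 'a set \<Rightarrow> real \<Rightarrow> bool" where
  "sensitivity_constant D f V \<delta> \<longleftrightarrow> V \<noteq> {} \<and> V \<subseteq> D 0 \<and> \<delta> > 0 \<and>
     (\<forall>x\<in>V. \<forall>U. x \<in> interior U \<longrightarrow>
        (\<exists>y\<in>V \<inter> U. \<exists>n\<ge>1. dist (orbit_map f n x) (orbit_map f n y) > \<delta>))"

definition sensitive_in ::
  "(nat \<Rightarrow> 'a::metric_space set) \<Rightarrow> (nat \<Rightarrow> 'a \<Rightarrow> 'a) \<Rightarrow> 'a set \<Rightarrow> bool" where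
  "sensitive_in D f V \<longleftrightarrow> (\<exists>\<delta>. sensitivity_constant D f V \<delta>)"

end

theory Submission
  imports Defs
begin

text \<open>If every orbit starting in \<open>V\<close> near \<open>x\<close> stayed within \<open>\<delta>\<close> of the orbit of \<open>x\<close>, then comparison
  with a nearby periodic point, whose orbit is finite, would confine all these orbits to one ball.
  Since \<open>V\<close> is unbounded, they could never visit the part of \<open>V\<close> outside that ball, against
  transitivity.\<close>

lemma orbit_map_mod_period:
  assumes "periodic_point D f k p"
  shows "orbit_map f n p = orbit_map f (n mod k) p"
proof -
  \<comment> \<open>Induction on the number \<open>j\<close> of whole periods; division of
    \<open>n\<close> by \<open>k\<close> with remainder then picks \<open>m\<close> and
    \<open>j\<close>.\<close>
  have "orbit_map f (m + j * k) p = orbit_map f m p" for m j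
    using assms unfolding periodic_point_def
    by (induction j) (auto simp: add.assoc[symmetric] add.commute[of k])
  from this[of "n mod k" "n div k"] show ?thesis
    by simp
qed

lemma finite_periodic_orbit:
  assumes "periodic_point D f k p"
  shows "finite (range (\<lambda>n. orbit_map f n p))"
proof (rule finite_subset)
  have "k \<ge> 1"
    using assms by (simp add: periodic_point_def)
  then show "range (\<lambda>n. orbit_map f n p) \<subseteq> (\<lambda>n. orbit_map f n p) ` {..<k}"
    using orbit_map_mod_period[OF assms] by (force intro: image_eqI)
qed simp

lemma unbounded_sensitivity_constant:
  fixes f :: "nat \<Rightarrow> 'a::metric_space \<Rightarrow> 'a"
  assumes unbounded: "\<not> bounded V"
    and transitive: "transitive_in D f V"
    and dense: "V \<subseteq> closure (periodic_points D f \<inter> V)"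
    and "\<delta> > 0"
  shows "sensitivity_constant D f V \<delta>"
proof -
  have "\<exists>y\<in>V \<inter> U. \<exists>n\<ge>1. dist (orbit_map f n x) (orbit_map f n y) > \<delta>"
    if "x \<in> V" "x \<in> interior U" for x U
  proof (rule ccontr)
    assume "\<not> ?thesis"
    then have close: "dist (orbit_map f n x) (orbit_map f n y) \<le> \<delta>"
      if "y \<in> V" "y \<in> U" "n \<ge> 1" for y n
      using that by force
    \<comment> \<open>Density yields points only in open sets, and \<open>U\<close> need not be
      open, hence the passage to its interior.\<close>
    have "interior U \<inter> closure (periodic_points D f \<inter> V) \<noteq> {}"
      using that dense by blast
    then have "interior U \<inter> (periodic_points D f \<inter> V) \<noteq> {}"
      by (simp add: open_Int_closure_eq_empty)
    then obtain p k where p: "p \<in> U" "p \<in> V" "periodic_point D f k p"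
      using interior_subset by (force simp: periodic_points_def)
    \<comment> \<open>One \<open>r\<close> serves all \<open>n\<close>, as the orbit of
      \<open>p\<close> is finite. Nothing comparable is known yet about the orbit of
      \<open>x\<close>.\<close>
    obtain r where r: "dist x (orbit_map f n p) \<le> r" for n
      using finite_imp_bounded[OF finite_periodic_orbit[OF p(3)]]
      by (auto simp: bounded_any_center[of _ x])
    have confined: "orbit_map f n y \<in> cball x (r + 2 * \<delta>)"
      if "y \<in> V" "y \<in> U" "n \<ge> 1" for y n
    proof -
      \<comment> \<open>The path runs through the orbits of \<open>p\<close>, \<open>x\<close> and
        \<open>y\<close>: each of the last two legs costs at most \<delta>, whence the radius
        \<open>r + 2 * \<delta>\<close>.\<close>
      have "dist x (orbit_map f n y) \<le> dist x (orbit_map f n p)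
          + dist (orbit_map f n x) (orbit_map f n p) + dist (orbit_map f n x) (orbit_map f n y)"
        by metric
      then show ?thesis
        using r[of n] close[OF p(2,1) that(3)] close[OF that] by simp
    qed
    \<comment> \<open>The complement of a closed ball is open, and an unbounded \<open>V\<close>
      meets it whatever the radius; so \<delta> may be arbitrarily large.\<close>
    let ?U\<^sub>0 = "V \<inter> interior U" and ?V\<^sub>0 = "V \<inter> - cball x (r + 2 * \<delta>)"
    have "?V\<^sub>0 \<noteq> {}"
      using unbounded bounded_subset[OF bounded_cball] by blast
    moreover have "?U\<^sub>0 \<noteq> {}"
      using that by blast
    moreover have "openin (top_of_set V) ?U\<^sub>0" "openin (top_of_set V) ?V\<^sub>0"
      by (auto intro!: openin_open_Int)
    ultimately obtain n where "n \<ge> 1" "orbit_map f n ` ?U\<^sub>0 \<inter> ?V\<^sub>0 \<noteq> {}"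
      using transitive unfolding transitive_in_def by metis
    then show False
      using confined interior_subset[of U] by blast
  qed
  then show ?thesis
    using transitive \<open>\<delta> > 0\<close> by (simp add: sensitivity_constant_def transitive_in_def)
qed

theorem theorem3p1:
  fixes D :: "nat \<Rightarrow> 'a::metric_space set"
    and f :: "nat \<Rightarrow> 'a \<Rightarrow> 'a"
    and V :: "'a set"
  assumes "nonautonomous_system D f"
    and "V \<subseteq> D 0"
    and "\<not> bounded V"
    and "transitive_in D f V"
    and "V \<subseteq> closure (periodic_points D f \<inter> V)"
  shows "sensitive_in D f V \<and> (\<forall>\<delta>\<^sub>0>0. sensitivity_constant D f V \<delta>\<^sub>0)"
  \<comment> \<open>The constant 1 witnesses sensitivity.\<close>
  using unbounded_sensitivity_constant[OF assms(3-5)] zero_less_one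
  unfolding sensitive_in_def by blast

end
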